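(* Let $d\ge 3$ and let $r\in\mathbb{N}$ satisfy $r>2^d d!$. Then for every non-negative integer $m\le (r-2^d d!)^d$ there is a polytope $P\in\mathcal{P}^d(r)$ with $v(P)=r^d-m$.
   Context: $\mathbb{N}$ denotes the positive integers. Let $e_1,\ldots,e_d$ be the standard basis of $\mathbb{R}^d$. A convex lattice polytope in $\mathbb{R}^d$ is a convex polytope all of whose vertices belong to $\mathbb{Z}^d$ (it need not be full-dimensional). For $r\in\mathbb{N}$ let $A(r)=\mathrm{conv}\{re_1,\ldots,re_d\}$ and $S(r)=\mathrm{conv}(A(r)\cup\{0\})$. Let $\mathcal{P}^d(r)$ be the collection of all convex lattice polytopes $P\subset\mathbb{R}^d$ with $A(r)\subset P\subset S(r)$. For $P\in\mathcal{P}^d(r)$ put $v(P)=d!\,\mathrm{vol}(P)$, where $\mathrm{vol}$ is $d$-dimensional volume; $v(P)$ is an integer with $0\le v(P)\le r^d$. *)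

theory Defs
  imports "HOL-Analysis.Analysis"
begin

definition integer_lattice :: "(real ^ 'n) set" where
  "integer_lattice = {x. \<forall>i. x $ i \<in> \<int>}"

text \<open>Like \<^const>\<open>polytope\<close>, this includes the empty set and
  polytopes that are not full-dimensional.\<close>

definition lattice_polytope :: "(real ^ 'n) set \<Rightarrow> bool" where
  "lattice_polytope P \<longleftrightarrow>
     polytope P \<and> {x. x extreme_point_of P} \<subseteq> integer_lattice"

definition corner_face :: "nat \<Rightarrow> (real ^ 'n) set" where
  "corner_face r = convex hull {real r *\<^sub>R axis i 1 | i. True}"

definition corner_simplex :: "nat \<Rightarrow> (real ^ 'n) set" where
  "corner_simplex r = convex hull (corner_face r \<union> {0})"

text \<open>The dimension \<open>d\<close> is \<open>CARD('n)\<close>.\<close>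

definition lattice_polytopes_between :: "nat \<Rightarrow> (real ^ 'n) set set" where
  "lattice_polytopes_between r = {P. lattice_polytope P \<and> corner_face r \<subseteq> P \<and> P \<subseteq> corner_simplex r}"

text \<open>Since \<^const>\<open>lebesgue\<close> is the measure of the ambient space,
  a polytope that is not full-dimensional has normalized volume 0.\<close>

definition normalized_volume :: "(real ^ 'n) set \<Rightarrow> real" where
  "normalized_volume P = fact CARD('n) * measure lebesgue P"

end

theory Submission
  imports Defs
begin

text \<open>
  Write \<open>d\<close> for the dimension and \<open>e\<^sub>i\<close> for the unit vectors. The polytope is obtained from the
  corner simplex \<open>conv {0, r e\<^sub>1, \<dots>, r e\<^sub>d}\<close>, of normalized volume \<open>r\<^sup>d\<close>, by cutting off pieces of
  total normalized volume \<open>m\<close>.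

  Let \<open>k\<close> be maximal with \<open>k\<^sup>d \<le> m\<close>. Cutting off \<open>conv {0, k e\<^sub>1, \<dots>, k e\<^sub>d}\<close> removes \<open>k\<^sup>d\<close> and creates the
  vertices \<open>k e\<^sub>i\<close>. The edges at \<open>k e\<^sub>i\<close> have the directions \<open>e\<^sub>i\<close> and \<open>e\<^sub>j - e\<^sub>i\<close> for \<open>j \<noteq> i\<close>, which form a
  lattice basis. So cutting off the simplex with integral edge lengths \<open>L i j\<close> along these edges
  removes exactly \<open>\<Prod>\<^sub>j L i j\<close>. The length in direction \<open>e\<^sub>i\<close> is bounded by \<open>r - k\<close>, which is at least
  \<open>2\<^sup>d d!\<close>; if the other lengths are at most \<open>k/2\<close>, the cuts at different vertices do not interfere.

  It remains to write \<open>R = m - k\<^sup>d\<close> as a sum of \<open>d\<close> such products. Put \<open>h = k div 2\<close> and expand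
  \<open>R = a\<^sub>0 h\<^bsup>d-1\<^esup> + a\<^sub>1 h\<^bsup>d-2\<^esup> + \<dots> + a\<^bsub>d-1\<^esub>\<close> in base \<open>h\<close>, with an unrestricted leading digit. The
  digit \<open>a\<^sub>q\<close> is realized at the \<open>q\<close>-th vertex, with one edge length \<open>a\<^sub>q\<close>, exactly \<open>d-1-q\<close> edge lengths \<open>h\<close>
  and all others \<open>1\<close>. Only \<open>a\<^sub>0\<close> can exceed \<open>k/2\<close>, and it is used for the direction \<open>e\<^sub>i\<close>. This is
  possible because \<open>R < (k+1)\<^sup>d - k\<^sup>d \<le> d (k+1)\<^bsup>d-1\<^esup> \<le> d 4\<^bsup>d-1\<^esup> h\<^bsup>d-1\<^esup> \<le> 2\<^sup>d d! h\<^bsup>d-1\<^esup>\<close>.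
  The last but one inequality is \<open>k + 1 \<le> 4 h\<close>, which needs \<open>k \<ge> 2\<close>. For \<open>k = 1\<close> a single cut with edge
  lengths \<open>R, 1, \<dots>, 1\<close> suffices, and \<open>k = 0\<close> means \<open>m = 0\<close>.

  The geometric content is in the lemmas \<open>cut_off_vertex\<close>, \<open>normalized_volume_edge_simplex\<close> and
  \<open>normalized_volume_cut_vertices\<close>.
\<close>

section \<open>Cutting a simplex off a vertex of a polytope\<close>

lemma lmeasurable_convex_hull_finite:
  fixes V :: "'a::euclidean_space set"
  assumes "finite V"
  shows "convex hull V \<in> lmeasurable"
  using assms by (simp add: finite_imp_compact_convex_hull lmeasurable_compact)

lemma in_simplex:
  fixes v :: "'a::real_vector" and u :: "'n::finite \<Rightarrow> 'a"
  assumes c: "\<And>j. 0 \<le> c j" "sum c UNIV \<le> 1"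
  shows "v + (\<Sum>j\<in>UNIV. c j *\<^sub>R (u j - v)) \<in> convex hull (insert v (range u))" (is "_ \<in> ?H")
proof -
  let ?c = "\<lambda>q. case q of None \<Rightarrow> 1 - sum c UNIV | Some j \<Rightarrow> c j"
  let ?y = "\<lambda>q. case q of None \<Rightarrow> v | Some j \<Rightarrow> u j"
  have sum_option: "sum f (UNIV :: 'n option set) = f None + (\<Sum>j\<in>UNIV. f (Some j))"
    for f :: "'n option \<Rightarrow> 'b::comm_monoid_add"
    by (simp add: UNIV_option_conv sum.reindex)
  have "(\<Sum>q\<in>UNIV. ?c q *\<^sub>R ?y q) \<in> ?H"
  proof (rule convex_sum)
    show "sum ?c UNIV = 1" by (simp add: sum_option)
    show "0 \<le> ?c q" for q :: "'n option" using c by (cases q) auto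
    show "?y q \<in> ?H" for q by (cases q) (auto intro: hull_inc)
  qed auto
  also have "(\<Sum>q\<in>UNIV. ?c q *\<^sub>R ?y q) = v + (\<Sum>j\<in>UNIV. c j *\<^sub>R (u j - v))"
    by (simp add: sum_option algebra_simps sum_subtractf scaleR_sum_left)
  finally show ?thesis .
qed

text \<open>
  The linear functional \<open>a\<close> is \<open>1\<close> on every \<open>u j - v\<close>, so the hypothesis on \<open>W\<close> says that \<open>W\<close> lies in
  the cone with apex \<open>v\<close> spanned by these vectors, on or beyond the hyperplane \<open>a \<bullet> (x - v) = 1\<close>
  through the points \<open>u j\<close>. The hyperplane therefore splits the hull of \<open>v\<close> and \<open>W\<close> into the simplex
  with apex \<open>v\<close> and the hull of \<open>W\<close> and the \<open>u j\<close>, whose intersection has volume \<open>0\<close>.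
\<close>

lemma cut_off_vertex:
  fixes v a :: "real ^ 'n" and u :: "'n \<Rightarrow> real ^ 'n"
  assumes "finite W" "W \<noteq> {}"
    and a: "\<And>j. a \<bullet> (u j - v) = 1"
    and u: "\<And>j. u j \<in> convex hull (insert v W)"
    and W: "\<And>w. w \<in> W \<Longrightarrow>
      \<exists>c. (\<forall>j. 0 \<le> c j) \<and> 1 \<le> sum c UNIV \<and> w = v + (\<Sum>j\<in>UNIV. c j *\<^sub>R (u j - v))"
  shows "normalized_volume (convex hull (W \<union> range u)) =
    normalized_volume (convex hull (insert v W)) - normalized_volume (convex hull (insert v (range u)))"
proof -
  let ?Q = "convex hull (W \<union> range u)" and ?T = "convex hull (insert v (range u))"
    and ?P = "convex hull (insert v W)"
  \<comment> \<open>The part of the cone at \<open>v\<close> that lies on or beyond the hyperplane.\<close>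
  define C where "C = {v + (\<Sum>j\<in>UNIV. c j *\<^sub>R (u j - v)) | c. (\<forall>j. 0 \<le> c j) \<and> 1 \<le> sum c UNIV}"
  have "convex C"
  proof (rule convexI)
    fix x y :: "real ^ 'n" and s t :: real
    assume "x \<in> C" "y \<in> C" and st: "0 \<le> s" "0 \<le> t" "s + t = 1"
    then obtain c c' where c: "\<And>j. 0 \<le> c j" "1 \<le> sum c UNIV" "x = v + (\<Sum>j\<in>UNIV. c j *\<^sub>R (u j - v))"
      and c': "\<And>j. 0 \<le> c' j" "1 \<le> sum c' UNIV" "y = v + (\<Sum>j\<in>UNIV. c' j *\<^sub>R (u j - v))"
      unfolding C_def by blast
    have "s *\<^sub>R x + t *\<^sub>R y = (s + t) *\<^sub>R v + (\<Sum>j\<in>UNIV. (s * c j + t * c' j) *\<^sub>R (u j - v))"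
      unfolding c(3) c'(3)
      by (simp add: scaleR_add_right scaleR_add_left sum.distrib scaleR_sum_right)
    moreover have "1 \<le> (\<Sum>j\<in>UNIV. s * c j + t * c' j)"
    proof -
      have "1 = s * 1 + t * 1" using st by simp
      also have "\<dots> \<le> s * sum c UNIV + t * sum c' UNIV"
        using c c' st by (intro add_mono mult_left_mono) auto
      finally show ?thesis by (simp add: sum.distrib sum_distrib_left)
    qed
    moreover have "\<forall>j. 0 \<le> s * c j + t * c' j" using c c' st by simp
    ultimately show "s *\<^sub>R x + t *\<^sub>R y \<in> C"
      unfolding C_def using st(3) by (auto intro!: exI[of _ "\<lambda>j. s * c j + t * c' j"])
  qed
  moreover have "W \<subseteq> C" using W unfolding C_def by blast
  ultimately have WC: "convex hull W \<subseteq> C" by (simp add: hull_minimal)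
  have "?P \<subseteq> ?Q \<union> ?T"
  proof
    fix x assume "x \<in> ?P"
    then obtain t w where t: "0 \<le> t" "t \<le> 1" and w: "w \<in> convex hull W" and "x = (1 - t) *\<^sub>R v + t *\<^sub>R w"
      unfolding convex_hull_insert[OF \<open>W \<noteq> {}\<close>] by (auto simp: eq_diff_eq[symmetric])
    then have x: "x = v + t *\<^sub>R (w - v)" by (simp add: algebra_simps)
    from w WC obtain c where c: "\<And>j. 0 \<le> c j" "1 \<le> sum c UNIV" and "w = v + (\<Sum>j\<in>UNIV. c j *\<^sub>R (u j - v))"
      unfolding C_def by blast
    then have scaled: "v + b *\<^sub>R (w - v) = v + (\<Sum>j\<in>UNIV. (b * c j) *\<^sub>R (u j - v))" for b
      by (simp add: scaleR_sum_right)
    define s where "s = sum c UNIV"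
    show "x \<in> ?Q \<union> ?T"
    proof (cases "t * s \<le> 1")
      case True
      then have "x \<in> ?T"
        unfolding x scaled using c t
        by (intro in_simplex) (auto simp: s_def sum_distrib_left[symmetric])
      then show ?thesis by simp
    next
      case False
      have s: "1 \<le> s" using c by (simp add: s_def)
      have "t * s \<le> s" using t s by (simp add: mult_le_cancel_right1)
      with False have s1: "1 < s" by simp
      \<comment> \<open>The segment from \<open>v\<close> to \<open>w\<close> leaves the simplex at \<open>z\<close>, and \<open>x\<close> lies beyond \<open>z\<close>.\<close>
      define z where "z = v + (1 / s) *\<^sub>R (w - v)"
      have "z = (\<Sum>j\<in>UNIV. (c j / s) *\<^sub>R u j)"
      proof -
        have "(\<Sum>j\<in>UNIV. c j / s) = 1"
          using s by (simp add: s_def sum_divide_distrib[symmetric])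
        then show ?thesis
          unfolding z_def scaled
          by (simp add: scaleR_diff_right sum_subtractf scaleR_sum_left[symmetric])
      qed
      also have "\<dots> \<in> ?Q"
        using c s by (intro convex_sum) (auto simp: s_def sum_divide_distrib[symmetric] intro: hull_inc)
      finally have z: "z \<in> ?Q" .
      define \<theta> where "\<theta> = (t - 1 / s) / (1 - 1 / s)"
      have \<theta>: "0 \<le> \<theta>" "\<theta> \<le> 1"
        using False s1 t by (auto simp: \<theta>_def field_simps)
      have "\<theta> * (1 - 1 / s) = t - 1 / s"
        using s1 by (simp add: \<theta>_def)
      then have t_eq: "t = (1 - \<theta>) * (1 / s) + \<theta>"
        by (simp add: algebra_simps diff_divide_distrib)
      have "x = (1 - \<theta>) *\<^sub>R z + \<theta> *\<^sub>R w"
        unfolding x z_def by (subst t_eq) (simp add: algebra_simps)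
      also have "\<dots> \<in> ?Q"
        using z w \<theta> hull_mono[of W "W \<union> range u"] by (intro convexD) auto
      finally show ?thesis by simp
    qed
  qed
  moreover have "range u \<subseteq> ?P" "insert v W \<subseteq> ?P"
    using u by (auto intro: hull_inc)
  then have "?Q \<subseteq> ?P" "?T \<subseteq> ?P"
    by (simp_all add: hull_minimal)
  ultimately have P: "?P = ?Q \<union> ?T" by blast
  have "?Q \<subseteq> {x. a \<bullet> v + 1 \<le> a \<bullet> x}"
  proof (intro hull_minimal convex_halfspace_ge)
    have "a \<bullet> v + 1 \<le> a \<bullet> w" if "w \<in> W" for w
      using W[OF that] a by (auto simp: inner_add_right inner_sum_right)
    moreover have "a \<bullet> v + 1 \<le> a \<bullet> u j" for j
      using a[of j] by (simp add: inner_diff_right)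
    ultimately show "W \<union> range u \<subseteq> {x. a \<bullet> v + 1 \<le> a \<bullet> x}" by auto
  qed
  moreover have "?T \<subseteq> {x. a \<bullet> x \<le> a \<bullet> v + 1}"
  proof (intro hull_minimal convex_halfspace_le)
    have "a \<bullet> u j \<le> a \<bullet> v + 1" for j
      using a[of j] by (simp add: inner_diff_right)
    then show "insert v (range u) \<subseteq> {x. a \<bullet> x \<le> a \<bullet> v + 1}" by auto
  qed
  ultimately have "?Q \<inter> ?T \<subseteq> {x. a \<bullet> x = a \<bullet> v + 1}" by force
  moreover have "a \<noteq> 0" using a by auto
  ultimately have "negligible (?Q \<inter> ?T)"
    by (intro negligible_subset[OF negligible_hyperplane]) auto
  moreover have "?Q \<in> lmeasurable" "?T \<in> lmeasurable"
    using \<open>finite W\<close> by (auto intro: lmeasurable_convex_hull_finite)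
  ultimately have "measure lebesgue ?P = measure lebesgue ?Q + measure lebesgue ?T"
    unfolding P by (simp add: measure_Un3 negligible_imp_measure0)
  then show ?thesis by (simp add: normalized_volume_def algebra_simps)
qed

section \<open>Volumes of unimodular corners\<close>

lemma normalized_volume_axis_simplex:
  fixes L :: "'n::finite \<Rightarrow> real"
  assumes "\<And>j. 0 \<le> L j"
  shows "normalized_volume (convex hull (insert 0 (range (\<lambda>j. L j *\<^sub>R axis j 1)) :: (real ^ 'n) set)) = (\<Prod>j\<in>UNIV. L j)"
proof -
  let ?std = "convex hull (insert 0 Basis) :: (real ^ 'n) set"
  let ?f = "\<lambda>x :: real ^ 'n. \<chi> j. L j * x $ j"
  let ?T = "convex hull (insert 0 (range (\<lambda>j. L j *\<^sub>R axis j 1))) :: (real ^ 'n) set"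
  have std: "?std \<in> lmeasurable" by (simp add: lmeasurable_convex_hull_finite)
  have lin: "linear ?f" by (rule linearI) (auto simp: vec_eq_iff algebra_simps)
  have f_axis: "?f (axis j 1) = L j *\<^sub>R axis j 1" for j by (auto simp: vec_eq_iff axis_def)
  have Basis: "(Basis :: (real ^ 'n) set) = range (\<lambda>j. axis j 1)"
    by (auto simp: Basis_vec_def)
  have "?f ` insert 0 Basis = insert 0 (range (\<lambda>j. L j *\<^sub>R axis j 1))"
    unfolding Basis image_insert image_image f_axis linear_0[OF lin] ..
  then have "?T = ?f ` ?std"
    by (simp add: convex_hull_linear_image[OF lin])
  then have "measure lebesgue ?T = \<bar>prod L UNIV\<bar> * measure lebesgue ?std"
    using measure_stretch[OF std, of L] by simp
  also have "measure lebesgue ?std = 1 / fact CARD('n)"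
    using content_std_simplex[where 'a="real ^ 'n"]
    by (subst measure_completion) (auto simp: compact_imp_closed finite_imp_compact_convex_hull)
  finally show ?thesis
    using assms by (simp add: normalized_volume_def prod_nonneg)
qed

lemma measure_shear:
  fixes S :: "(real ^ 'n) set"
  assumes "m \<noteq> n" "S \<in> lmeasurable"
  defines "h \<equiv> \<lambda>x :: real ^ 'n. \<chi> i. if i = m then x $ m + x $ n else x $ i"
  shows "h ` S \<in> lmeasurable \<and> measure lebesgue (h ` S) = measure lebesgue S"
proof -
  have lin: "linear h"
    unfolding h_def by (rule linearI) (auto simp: vec_eq_iff algebra_simps)
  have "measure lebesgue (h ` cbox a b) = 1 * measure lebesgue (cbox a b)" for a b
  proof (cases "cbox a b = {}")
    case False
    \<comment> \<open>Translate the box so that its \<open>n\<close>-th side starts at \<open>0\<close>; the shear commutes with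
      translations up to another translation.\<close>
    let ?v = "axis n (- (a $ n)) :: real ^ 'n"
    have "h ` (+) ?v ` cbox a b = (+) (h ?v) ` h ` cbox a b"
      using linear_add[OF lin] by (simp add: image_image)
    then have "measure lebesgue (h ` cbox a b) = measure lebesgue (h ` (+) ?v ` cbox a b)"
      by (simp add: measure_translation)
    also have "\<dots> = measure lebesgue ((+) ?v ` cbox a b)"
      using measure_shear_interval[OF \<open>m \<noteq> n\<close>, of "?v + a" "?v + b"] False
      by (simp add: cbox_translation h_def)
    finally show ?thesis by (simp add: measure_translation)
  qed simp
  from measure_linear_sufficient[OF lin assms(2) this] show ?thesis by simp
qed

text \<open>The map is a composition of elementary shears, one for each element of \<open>J\<close>.\<close>

lemma measure_multi_shear:
  fixes S :: "(real ^ 'n) set"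
  assumes "m \<notin> J" "S \<in> lmeasurable"
  defines "h \<equiv> \<lambda>J. \<lambda>x :: real ^ 'n. \<chi> i. if i = m then x $ m + (\<Sum>j\<in>J. x $ j) else x $ i"
  shows "h J ` S \<in> lmeasurable \<and> measure lebesgue (h J ` S) = measure lebesgue S"
proof -
  have "finite J" by simp
  from this assms(1) show ?thesis
  proof (induction J)
    case empty
    have "h {} = id" by (auto simp: h_def vec_eq_iff)
    then show ?case using assms(2) by simp
  next
    case (insert n J)
    have "h (insert n J) = (\<lambda>x. \<chi> i. if i = m then x $ m + x $ n else x $ i) \<circ> h J"
      using insert by (auto simp: h_def vec_eq_iff fun_eq_iff)
    then show ?case
      using insert measure_shear[of m n "h J ` S"] by (simp only: image_comp[symmetric]) auto
  qed
qed

text \<open>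
  The primitive direction of the \<open>j\<close>-th edge at the vertex \<open>k e\<^sub>i\<close> of the truncated simplex
  \<open>conv {k e\<^sub>1, \<dots>, k e\<^sub>d, r e\<^sub>1, \<dots>, r e\<^sub>d}\<close>: the index \<open>i\<close> itself stands for
  the edge that points away from the origin.
\<close>

definition edge :: "'n \<Rightarrow> 'n \<Rightarrow> real ^ 'n::finite" where
  "edge i j = (if j = i then axis i 1 else axis j 1 - axis i 1)"

text \<open>
  Replacing the \<open>i\<close>-th coordinate by the sum of all coordinates preserves volume and sends the edge
  directions at \<open>k e\<^sub>i\<close> to the standard basis.
\<close>

lemma normalized_volume_edge_simplex:
  fixes L :: "'n::finite \<Rightarrow> real" and v :: "real ^ 'n"
  assumes "\<And>j. 0 \<le> L j"
  shows "normalized_volume (convex hull (insert v (range (\<lambda>j. v + L j *\<^sub>R edge i j)))) = (\<Prod>j\<in>UNIV. L j)"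
proof -
  let ?T = "convex hull (insert 0 (range (\<lambda>j. L j *\<^sub>R edge i j)))"
  let ?h = "\<lambda>x :: real ^ 'n. \<chi> p. if p = i then x $ i + (\<Sum>j\<in>-{i}. x $ j) else x $ p"
  have lin: "linear ?h"
    by (rule linearI) (auto simp: vec_eq_iff algebra_simps sum.distrib sum_distrib_left)
  have "?h (edge i j) = axis j 1" for j
    by (cases "j = i") (auto simp: edge_def vec_eq_iff axis_def sum_subtractf)
  then have "?h (L j *\<^sub>R edge i j) = L j *\<^sub>R axis j 1" for j
    using linear_scale[OF lin, of "L j" "edge i j"] by simp
  then have "?h ` insert 0 (range (\<lambda>j. L j *\<^sub>R edge i j)) = insert 0 (range (\<lambda>j. L j *\<^sub>R axis j 1))"
    using linear_0[OF lin] by (simp add: image_image)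
  then have "?h ` ?T = convex hull (insert 0 (range (\<lambda>j. L j *\<^sub>R axis j 1)))"
    by (simp only: convex_hull_linear_image[OF lin])
  moreover have "measure lebesgue (?h ` ?T) = measure lebesgue ?T"
    using measure_multi_shear[of i "-{i}" ?T] by (simp add: lmeasurable_convex_hull_finite)
  ultimately have "normalized_volume ?T = (\<Prod>j\<in>UNIV. L j)"
    using normalized_volume_axis_simplex[of L, OF assms] by (simp add: normalized_volume_def)
  moreover have "convex hull (insert v (range (\<lambda>j. v + L j *\<^sub>R edge i j))) = (+) v ` ?T"
    by (simp add: convex_hull_translation[symmetric] image_image)
  ultimately show ?thesis by (simp add: normalized_volume_def measure_translation)
qed

text \<open>
  The inverse of that shear: the coordinates of \<open>w\<close> at the vertex \<open>k e\<^sub>i\<close> are the coordinates of \<open>w\<close>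
  itself, except that the \<open>i\<close>-th one is the height of \<open>w\<close> above the facet \<open>\<Sum>\<^sub>p x\<^sub>p = k\<close>.
\<close>

lemma edge_expansion:
  fixes w :: "real ^ 'n"
  shows "w = k *\<^sub>R axis i 1 + (\<Sum>j\<in>UNIV. (if j = i then (\<Sum>p\<in>UNIV. w $ p) - k else w $ j) *\<^sub>R edge i j)"
    (is "_ = _ + (\<Sum>j\<in>UNIV. ?t j *\<^sub>R _)")
proof -
  have "(\<Sum>j\<in>UNIV. ?t j *\<^sub>R edge i j) = ?t i *\<^sub>R axis i 1 + (\<Sum>j\<in>-{i}. w $ j *\<^sub>R (axis j 1 - axis i 1))"
    by (subst sum.remove[of _ i]) (auto simp: edge_def Compl_eq_Diff_UNIV intro!: sum.cong)
  also have "\<dots> = ?t i *\<^sub>R axis i 1 + (\<Sum>j\<in>-{i}. w $ j *\<^sub>R axis j 1) - (\<Sum>j\<in>-{i}. w $ j) *\<^sub>R axis i 1"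
    by (simp add: scaleR_diff_right sum_subtractf scaleR_sum_left)
  also have "(\<Sum>j\<in>-{i}. w $ j) = (\<Sum>p\<in>UNIV. w $ p) - w $ i"
    by (subst (2) sum.remove[of _ i]) (auto simp: Compl_eq_Diff_UNIV)
  also have "(\<Sum>j\<in>-{i}. w $ j *\<^sub>R axis j 1) = w - w $ i *\<^sub>R axis i 1"
    using basis_expansion[of w] sum.remove[of UNIV i "\<lambda>j. w $ j *s axis j 1"]
    by (simp add: Compl_eq_Diff_UNIV scalar_mult_eq_scaleR algebra_simps)
  finally show ?thesis by (simp add: algebra_simps)
qed


lemma edge_nth:
  "edge i j $ p = (if j = i then (if p = i then 1 else 0)
     else (if p = j then 1 else if p = i then -1 else 0))"
  by (auto simp: edge_def axis_def)

lemma sum_edge: "(\<Sum>p\<in>UNIV. edge i j $ p) = (if j = i then 1 else 0)"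
  by (simp add: edge_def axis_def sum_subtractf)

section \<open>The truncated simplex with cut vertices\<close>

text \<open>
  The truncated simplex has the vertices \<open>r e\<^sub>j\<close> and \<open>k e\<^sub>j\<close>; for \<open>i \<in> I\<close> the vertex \<open>k e\<^sub>i\<close> is replaced by
  the points at distance \<open>L i j\<close> on the edges that meet there.
\<close>

definition cut_vertices :: "real \<Rightarrow> real \<Rightarrow> ('n \<Rightarrow> 'n \<Rightarrow> real) \<Rightarrow> 'n set \<Rightarrow> (real ^ 'n::finite) set" where
  "cut_vertices r k L I = range (\<lambda>j. r *\<^sub>R axis j 1) \<union> (\<lambda>j. k *\<^sub>R axis j 1) ` (- I) \<union>
     (\<Union>i\<in>I. range (\<lambda>j. k *\<^sub>R axis i 1 + L i j *\<^sub>R edge i j))"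

lemma sum_delta_scaleR:
  fixes f :: "'n::finite \<Rightarrow> 'a::real_vector"
  shows "(\<Sum>j\<in>UNIV. (if j = p then c else 0) *\<^sub>R f j) = c *\<^sub>R f p"
  by (simp add: if_distrib[of "\<lambda>x. x *\<^sub>R _"] cong: if_cong)

lemma normalized_volume_truncated_simplex:
  fixes r k :: real and L :: "'n::finite \<Rightarrow> 'n \<Rightarrow> real"
  assumes k: "0 \<le> k" "k \<le> r"
  shows "normalized_volume (convex hull (cut_vertices r k L {})) = r ^ CARD('n) - k ^ CARD('n)"
proof (cases "k = 0")
  case True
  then show ?thesis
    using normalized_volume_axis_simplex[of "\<lambda>_ :: 'n. r"] k by (simp add: cut_vertices_def insert_commute)
next
  case False
  with k have k: "0 < k" "k \<le> r" by simp_all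
  let ?re = "\<lambda>j :: 'n. r *\<^sub>R axis j 1 :: real ^ 'n" and ?ke = "\<lambda>j :: 'n. k *\<^sub>R axis j 1 :: real ^ 'n"
  have "normalized_volume (convex hull (range ?re \<union> range ?ke)) =
    normalized_volume (convex hull (insert 0 (range ?re))) - normalized_volume (convex hull (insert 0 (range ?ke)))"
  proof (rule cut_off_vertex[where a = "\<chi> p. 1 / k"])
    show "(\<chi> p. 1 / k) \<bullet> (?ke j - 0) = 1" for j
      using k by (simp add: inner_axis)
    show "?ke j \<in> convex hull (insert 0 (range ?re))" for j
      using in_simplex[of "\<lambda>p. if p = j then k / r else 0" 0 ?re] k
      unfolding diff_zero sum_delta_scaleR by simp
    show "\<exists>c. (\<forall>j. 0 \<le> c j) \<and> 1 \<le> sum c UNIV \<and> w = 0 + (\<Sum>j\<in>UNIV. c j *\<^sub>R (?ke j - 0))"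
      if "w \<in> range ?re" for w
    proof -
      from that obtain p where "w = ?re p" by blast
      then show ?thesis
        using k unfolding diff_zero
        by (intro exI[of _ "\<lambda>j. if j = p then r / k else 0"], unfold sum_delta_scaleR) simp
    qed
  qed auto
  then show ?thesis
    using k by (simp add: cut_vertices_def normalized_volume_axis_simplex)
qed

text \<open>
  The vertices in \<open>I\<close> are cut one after the other. The last assumption keeps the cuts apart: relative
  to \<open>k e\<^sub>i\<close>, a point \<open>k e\<^sub>i\<^sub>' + L i' j (e\<^sub>j - e\<^sub>i\<^sub>')\<close> created by an earlier cut has \<open>i'\<close>-th coordinate
  \<open>k - L i' j \<ge> L i i'\<close>, so that it is not cut off again. For \<open>j = i\<close> it says that the two cuts on the
  edge from \<open>k e\<^sub>i\<close> to \<open>k e\<^sub>i\<^sub>'\<close> do not overlap.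
\<close>

lemma normalized_volume_cut_vertices:
  fixes r k :: real and L :: "'n::finite \<Rightarrow> 'n \<Rightarrow> real"
  assumes k: "0 \<le> k" "k \<le> r"
    and pos: "\<And>i j. i \<in> I \<Longrightarrow> 0 < L i j"
    and outer: "\<And>i. i \<in> I \<Longrightarrow> L i i \<le> r - k"
    and inner: "\<And>i j. i \<in> I \<Longrightarrow> j \<noteq> i \<Longrightarrow> L i j \<le> k"
    and apart: "\<And>i i' j. i \<in> I \<Longrightarrow> i' \<in> I \<Longrightarrow> i' \<noteq> i \<Longrightarrow> j \<noteq> i' \<Longrightarrow> L i i' + L i' j \<le> k"
  shows "normalized_volume (convex hull (cut_vertices r k L I)) =
    r ^ CARD('n) - k ^ CARD('n) - (\<Sum>i\<in>I. \<Prod>j\<in>UNIV. L i j)"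
proof -
  have "finite I" by simp
  then show ?thesis
    using pos outer inner apart
  proof (induction I)
    case empty
    then show ?case using normalized_volume_truncated_simplex[OF k, of L] by simp
  next
    case (insert i F)
    note pos = insert.prems(1) and outer = insert.prems(2) and inner = insert.prems(3)
      and apart = insert.prems(4)
    let ?v = "k *\<^sub>R axis i 1 :: real ^ 'n"
    let ?u = "\<lambda>i j. k *\<^sub>R axis i 1 + L i j *\<^sub>R edge i j"
    define W where "W = range (\<lambda>j. r *\<^sub>R axis j 1) \<union> (\<lambda>j. k *\<^sub>R axis j 1) ` (- insert i F) \<union>
      (\<Union>i\<in>F. range (?u i))"
    have F: "cut_vertices r k L F = insert ?v W" and iF: "cut_vertices r k L (insert i F) = W \<union> range (?u i)"
      using insert.hyps by (auto simp: cut_vertices_def W_def)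
    have "normalized_volume (convex hull (W \<union> range (?u i))) =
      normalized_volume (convex hull (insert ?v W)) - normalized_volume (convex hull (insert ?v (range (?u i))))"
    proof (rule cut_off_vertex[where a = "\<chi> p. if p = i then 1 / L i i else 1 / L i i + 1 / L i p"])
      let ?a = "(\<chi> p. if p = i then 1 / L i i else 1 / L i i + 1 / L i p) :: real ^ 'n"
      show "?a \<bullet> (?u i j - ?v) = 1" for j
        using pos[of i j] pos[of i i]
        by (auto simp: edge_def inner_diff_right inner_axis algebra_simps)
      show "?u i j \<in> convex hull (insert ?v W)" for j
      proof -
        \<comment> \<open>Each new vertex lies between \<open>k e\<^sub>i\<close> and the other end of an edge. That end is \<open>k e\<^sub>j\<close>,
          or the point left on the edge by an earlier cut at \<open>k e\<^sub>j\<close>, or \<open>r e\<^sub>i\<close> for \<open>j = i\<close>.\<close>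
        have segment: "?u i j \<in> convex hull (insert ?v W)"
          if w: "w \<in> W" and s: "0 < s" "L i j \<le> s" and dir: "w = ?v + s *\<^sub>R edge i j" for w s
        proof -
          have "(1 - L i j / s) *\<^sub>R ?v + (L i j / s) *\<^sub>R w \<in> convex hull (insert ?v W)"
            using w s pos[of i j] by (intro convexD_alt) (auto intro: hull_inc less_imp_le)
          also have "(1 - L i j / s) *\<^sub>R ?v + (L i j / s) *\<^sub>R w = ?u i j"
            using s by (simp add: dir algebra_simps)
          finally show ?thesis .
        qed
        consider "j = i" | "j \<noteq> i" "j \<notin> F" | "j \<noteq> i" "j \<in> F" by blast
        then show ?thesis
        proof cases
          case 1
          with pos[of i i] outer[of i] show ?thesis
            by (intro segment[of "r *\<^sub>R axis i 1" "r - k"]) (auto simp: W_def edge_def algebra_simps)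
        next
          case 2
          with inner[of i j] pos[of i j] show ?thesis
            by (intro segment[of "k *\<^sub>R axis j 1" k]) (auto simp: W_def edge_def algebra_simps)
        next
          case 3
          then have "?u j i \<in> W" unfolding W_def by blast
          with 3 pos[of i j] apart[of i j i] show ?thesis
            by (intro segment[of "?u j i" "k - L j i"]) (auto simp: edge_def algebra_simps)
        qed
      qed
      show "\<exists>c. (\<forall>j. 0 \<le> c j) \<and> 1 \<le> sum c UNIV \<and> w = ?v + (\<Sum>j\<in>UNIV. c j *\<^sub>R (?u i j - ?v))"
        if w: "w \<in> W" for w
      proof -
        let ?t = "\<lambda>j. if j = i then (\<Sum>p\<in>UNIV. w $ p) - k else w $ j"
        \<comment> \<open>A single large coordinate suffices to put \<open>w\<close> on or beyond the cutting hyperplane.\<close>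
        have *: ?thesis if nonneg: "\<And>p. 0 \<le> w $ p" and sum: "k \<le> (\<Sum>p\<in>UNIV. w $ p)" and far: "L i p \<le> ?t p" for p
        proof (intro exI[of _ "\<lambda>j. ?t j / L i j"] conjI allI)
          show c: "0 \<le> ?t j / L i j" for j
            using nonneg sum pos[of i j] by (auto intro!: divide_nonneg_pos)
          have "1 \<le> ?t p / L i p"
            using far pos[of i p] by (subst le_divide_eq_1_pos) simp_all
          also have "\<dots> \<le> (\<Sum>j\<in>UNIV. ?t j / L i j)"
            by (rule member_le_sum) (use c in auto)
          finally show "1 \<le> (\<Sum>j\<in>UNIV. ?t j / L i j)" .
          have scaled: "(?t j / L i j) *\<^sub>R (?u i j - ?v) = ?t j *\<^sub>R edge i j" for j
            using pos[of i j] by simp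
          show "w = ?v + (\<Sum>j\<in>UNIV. (?t j / L i j) *\<^sub>R (?u i j - ?v))"
            unfolding scaled by (rule edge_expansion)
        qed
        from w consider j where "w = r *\<^sub>R axis j 1" | j where "j \<noteq> i" "w = k *\<^sub>R axis j 1"
          | i' j where "i' \<in> F" "i' \<noteq> i" "w = ?u i' j"
          using insert.hyps unfolding W_def by auto
        then show ?thesis
        proof cases
          case 1
          then show ?thesis
            using k outer[of i] inner[of i j]
            by (intro *[of j]) (auto simp: axis_def simp flip: sum_distrib_left)
        next
          case 2
          then show ?thesis
            using k inner[of i j]
            by (intro *[of j]) (auto simp: axis_def simp flip: sum_distrib_left)
        next
          case 3
          \<comment> \<open>The large coordinate is the one of index \<open>i'\<close>.\<close>
          have "0 < L i' j" "0 < L i i'" "j \<noteq> i' \<Longrightarrow> L i i' + L i' j \<le> k" "L i i' \<le> k"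
            using pos[of i' j] pos[of i i'] apart[of i i' j] inner[of i i'] 3 by auto
          moreover have "(\<Sum>p\<in>UNIV. w $ p) = k + L i' j * (if j = i' then 1 else 0)"
            unfolding 3 by (simp add: sum.distrib axis_def sum_edge flip: sum_distrib_left)
          ultimately show ?thesis
            using 3 k by (intro *[of i']) (auto simp: axis_def edge_nth)
        qed
      qed
    qed (auto simp: W_def)
    moreover have "normalized_volume (convex hull (insert ?v (range (?u i)))) = (\<Prod>j\<in>UNIV. L i j)"
      using pos by (intro normalized_volume_edge_simplex) (auto intro: less_imp_le)
    moreover have "normalized_volume (convex hull (insert ?v W)) =
        r ^ CARD('n) - k ^ CARD('n) - (\<Sum>i\<in>F. \<Prod>j\<in>UNIV. L i j)"
      unfolding F[symmetric] by (rule insert.IH) (use pos outer inner apart in auto)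
    ultimately show ?case
      using insert.hyps by (simp add: iF)
  qed
qed

lemma in_corner_simplex:
  fixes x :: "real ^ 'n"
  assumes "0 < r" "\<And>p. 0 \<le> x $ p" "(\<Sum>p\<in>UNIV. x $ p) \<le> real r"
  shows "x \<in> corner_simplex r"
proof -
  let ?V = "range (\<lambda>j. real r *\<^sub>R axis j 1) :: (real ^ 'n) set"
  have "0 + (\<Sum>j\<in>UNIV. (x $ j / real r) *\<^sub>R (real r *\<^sub>R axis j 1 - 0)) \<in> convex hull (insert 0 ?V)"
    using assms by (intro in_simplex) (auto simp: sum_divide_distrib[symmetric])
  moreover have "(\<Sum>j\<in>UNIV. (x $ j / real r) *\<^sub>R (real r *\<^sub>R axis j 1)) = x"
    using assms(1) basis_expansion[of x] by (simp add: scalar_mult_eq_scaleR)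
  moreover have "convex hull (insert 0 ?V) \<subseteq> corner_simplex r"
    unfolding corner_simplex_def corner_face_def by (intro hull_mono) (auto intro: hull_inc)
  ultimately show ?thesis by auto
qed

lemma cut_vertices_lattice_polytope:
  fixes r k :: nat and L :: "'n::finite \<Rightarrow> 'n \<Rightarrow> nat"
  assumes "0 < r" "k \<le> r"
    and outer: "\<And>i. i \<in> I \<Longrightarrow> k + L i i \<le> r"
    and inner: "\<And>i j. i \<in> I \<Longrightarrow> j \<noteq> i \<Longrightarrow> L i j \<le> k"
  shows "convex hull (cut_vertices r k (\<lambda>i j. L i j) I) \<in> lattice_polytopes_between r"
proof -
  let ?V = "cut_vertices (real r) (real k) (\<lambda>i j. real (L i j)) I"
  have "finite ?V" by (simp add: cut_vertices_def)
  then have "polytope (convex hull ?V)"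
    unfolding polytope_def by blast
  moreover have "?V \<subseteq> integer_lattice"
    by (auto simp: cut_vertices_def integer_lattice_def edge_nth axis_def)
  then have "{x. x extreme_point_of (convex hull ?V)} \<subseteq> integer_lattice"
    using extreme_point_of_convex_hull by blast
  moreover have "corner_face r \<subseteq> convex hull ?V"
    unfolding corner_face_def by (intro hull_mono) (auto simp: cut_vertices_def)
  moreover have "convex hull ?V \<subseteq> corner_simplex r"
  proof (rule hull_minimal)
    show "?V \<subseteq> corner_simplex r"
    proof
      fix w assume "w \<in> ?V"
      then consider j where "w = real r *\<^sub>R axis j 1" | j where "w = real k *\<^sub>R axis j 1"
        | i j where "i \<in> I" "w = real k *\<^sub>R axis i 1 + real (L i j) *\<^sub>R edge i j"
        unfolding cut_vertices_def by auto
      then show "w \<in> corner_simplex r"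
      proof cases
        case 3
        have "(\<Sum>p\<in>UNIV. w $ p) = real k + real (L i j) * (if j = i then 1 else 0)"
          unfolding 3 by (simp add: sum.distrib axis_def sum_edge flip: sum_distrib_left)
        with 3 outer[of i] inner[of i j] assms(1,2) show ?thesis
          by (intro in_corner_simplex) (auto simp: axis_def edge_nth)
      qed (use assms(1,2) in \<open>auto intro!: in_corner_simplex simp: axis_def simp flip: sum_distrib_left\<close>)
    qed
    show "convex (corner_simplex r)" by (simp add: corner_simplex_def)
  qed
  ultimately show ?thesis
    by (simp add: lattice_polytopes_between_def lattice_polytope_def)
qed

lemma ex_cut_polytope:
  fixes r k :: nat and L :: "'n::finite \<Rightarrow> 'n \<Rightarrow> nat"
  assumes k: "0 < r" "k \<le> r"
    and pos: "\<And>i j. i \<in> I \<Longrightarrow> 0 < L i j"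
    and outer: "\<And>i. i \<in> I \<Longrightarrow> k + L i i \<le> r"
    and inner: "\<And>i j. i \<in> I \<Longrightarrow> j \<noteq> i \<Longrightarrow> L i j \<le> k"
    and apart: "\<And>i i' j. i \<in> I \<Longrightarrow> i' \<in> I \<Longrightarrow> i' \<noteq> i \<Longrightarrow> j \<noteq> i' \<Longrightarrow> L i i' + L i' j \<le> k"
  shows "\<exists>P \<in> (lattice_polytopes_between r :: (real ^ 'n) set set).
    normalized_volume P = real r ^ CARD('n) - real (k ^ CARD('n) + (\<Sum>i\<in>I. \<Prod>j\<in>UNIV. L i j))"
proof (rule bexI)
  let ?V = "cut_vertices (real r) (real k) (\<lambda>i j. real (L i j)) I"
  show "convex hull ?V \<in> lattice_polytopes_between r"
    using assms by (intro cut_vertices_lattice_polytope) auto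
  have outer': "real (L i i) \<le> real r - real k" if "i \<in> I" for i
    using outer[OF that] by linarith
  have apart': "real (L i i') + real (L i' j) \<le> real k"
    if "i \<in> I" "i' \<in> I" "i' \<noteq> i" "j \<noteq> i'" for i i' j
    using apart[OF that] by linarith
  show "normalized_volume (convex hull ?V) =
      real r ^ CARD('n) - real (k ^ CARD('n) + (\<Sum>i\<in>I. \<Prod>j\<in>UNIV. L i j))"
    using k pos inner outer' apart' by (subst normalized_volume_cut_vertices) auto
qed

section \<open>Representing the remainder by edge lengths\<close>

text \<open>Digits are numbered from the leading one, and only the leading digit may exceed the base.\<close>

lemma ex_base_expansion:
  fixes h R n :: nat
  assumes "0 < h"
  shows "\<exists>a. (\<forall>i. 0 < i \<longrightarrow> i \<le> n \<longrightarrow> a i < h) \<and> R = (\<Sum>i\<le>n. a i * h ^ (n - i))"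
proof (induction n arbitrary: R)
  case 0
  show ?case by (intro exI[of _ "\<lambda>_. R"]) simp
next
  case (Suc n)
  obtain a where a: "\<And>i. 0 < i \<Longrightarrow> i \<le> n \<Longrightarrow> a i < h" and sum: "R div h = (\<Sum>i\<le>n. a i * h ^ (n - i))"
    using Suc by blast
  have "R = R div h * h + R mod h" by simp
  also have "R div h * h = (\<Sum>i\<le>n. a i * h ^ (Suc n - i))"
    unfolding sum sum_distrib_right by (intro sum.cong) (auto simp: Suc_diff_le)
  finally show ?case
    using a assms by (intro exI[of _ "a(Suc n := R mod h)"]) (auto simp: le_Suc_eq)
qed

text \<open>The edge lengths at the \<open>q\<close>-th vertex multiply to the \<open>q\<close>-th term of the expansion.\<close>

lemma prod_digit_times_power:
  fixes a h n q :: nat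
  assumes "q \<le> n"
  shows "(\<Prod>j<Suc n. if j = 0 then a else if q < j then h else 1) = a * h ^ (n - q)"
proof -
  have "{..<n} \<inter> {j. q \<le> j} = {q..<n}" by auto
  then have "(\<Prod>j<n. if q \<le> j then h else 1) = h ^ (n - q)"
    by (simp add: prod.If_cases)
  then show ?thesis
    by (simp add: prod.lessThan_Suc_shift less_Suc_eq_le del: prod.lessThan_Suc)
qed

lemma power_Suc_le_add:
  fixes k :: nat
  shows "Suc k ^ Suc n \<le> k ^ Suc n + Suc n * Suc k ^ n"
proof (induction n)
  case (Suc n)
  have "Suc k ^ Suc (Suc n) = Suc k * Suc k ^ Suc n" by simp
  also have "\<dots> \<le> Suc k * (k ^ Suc n + Suc n * Suc k ^ n)"
    using Suc by (rule mult_le_mono2)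
  also have "\<dots> = k ^ Suc (Suc n) + k ^ Suc n + Suc n * Suc k ^ Suc n"
    by (simp add: algebra_simps)
  also have "\<dots> \<le> k ^ Suc (Suc n) + Suc k ^ Suc n + Suc n * Suc k ^ Suc n"
    by (intro add_mono power_mono) auto
  finally show ?case by simp
qed simp

lemma two_power_le_fact: "2 ^ n \<le> 2 * (fact n :: nat)"
proof (induction n)
  case (Suc n)
  show ?case
  proof (cases n)
    case (Suc n')
    have "2 ^ Suc n = 2 * (2 :: nat) ^ n" by simp
    also have "\<dots> \<le> 2 * (2 * fact n)" using Suc.IH by simp
    also have "\<dots> \<le> Suc n * (2 * fact n)" using Suc by (intro mult_le_mono1) simp
    finally show ?thesis by (simp add: algebra_simps)
  qed simp
qed simp

section \<open>Realizing all small volume defects\<close>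

theorem theorem3p1:
  fixes r m :: nat
  assumes "CARD('n::finite) \<ge> 3"
    and "r > 2 ^ CARD('n) * fact CARD('n)"
    and "m \<le> (r - 2 ^ CARD('n) * fact CARD('n)) ^ CARD('n)"
  shows "\<exists>P \<in> (lattice_polytopes_between r :: (real ^ 'n) set set).
           normalized_volume P = real r ^ CARD('n) - real m"
proof -
  define c :: nat where "c = 2 ^ CARD('n) * fact CARD('n)"
  obtain n where d: "CARD('n) = Suc n"
    using zero_less_card_finite[where 'a='n] gr0_implies_Suc by blast
  have "m < Suc m ^ Suc n"
    using self_le_power[of "Suc m" "Suc n"] by (simp del: power_Suc)
  then have "\<exists>j. m < j ^ Suc n" by (rule exI)
  \<comment> \<open>\<open>k\<close> will be the largest number with \<open>k ^ Suc n \<le> m\<close>, and \<open>j\<close> its successor.\<close>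
  define j where "j = (LEAST j. m < j ^ Suc n)"
  have "m < j ^ Suc n"
    unfolding j_def by (rule LeastI_ex) fact
  then obtain k where jk: "j = Suc k" by (cases j) auto
  have km: "k ^ Suc n \<le> m"
    using not_less_Least[of k "\<lambda>j. m < j ^ Suc n"] jk by (simp add: j_def[symmetric] del: power_Suc)
  have mk: "m < Suc k ^ Suc n"
    using \<open>m < j ^ Suc n\<close> jk by simp
  have c: "0 < c" "c < r" using assms(2) by (auto simp: c_def)
  have "k ^ Suc n \<le> (r - c) ^ Suc n"
    using km assms(3) unfolding c_def d by (rule le_trans)
  then have kr: "k + c \<le> r"
    using power_mono_iff[of k "r - c" "Suc n"] c by simp
  define R where "R = m - k ^ Suc n"
  have m: "m = k ^ Suc n + R" using km by (simp add: R_def)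
  show ?thesis
  proof (cases "k \<le> 1")
    case True
    have "R \<le> c" if "k = 1"
    proof -
      have "R \<le> 2 ^ Suc n" using mk that by (simp add: R_def numeral_2_eq_2)
      also have "\<dots> \<le> c" by (simp add: c_def d fact_ge_1 del: fact_Suc power_Suc)
      finally show ?thesis .
    qed
    moreover have "R = 0" if "k = 0" using mk that by (simp add: R_def)
    ultimately have R: "R \<le> c" "R = 0 \<or> k = 1" using True by linarith+
    obtain i0 :: 'n where True by blast
    define L where "L = (\<lambda>i j :: 'n. if j = i then R else 1)"
    define I where "I = (if R = 0 then {} else {i0})"
    have "k ^ CARD('n) + (\<Sum>i\<in>I. \<Prod>j\<in>UNIV. L i j) = m"
      using m by (auto simp: I_def L_def d)
    moreover have "\<exists>P \<in> (lattice_polytopes_between r :: (real ^ 'n) set set).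
      normalized_volume P = real r ^ CARD('n) - real (k ^ CARD('n) + (\<Sum>i\<in>I. \<Prod>j\<in>UNIV. L i j))"
      by (rule ex_cut_polytope) (use kr R c in \<open>auto simp: L_def I_def split: if_splits\<close>)
    ultimately show ?thesis by simp
  next
    case False
    define h where "h = k div 2"
    have h: "0 < h" "2 * h \<le> k" "Suc k \<le> 4 * h" using False unfolding h_def by presburger+
    have "R < Suc n * Suc k ^ n"
      using mk power_Suc_le_add[of k n] by (simp add: m)
    also have "\<dots> \<le> Suc n * (4 * h) ^ n"
      using h by (intro mult_le_mono2 power_mono) auto
    also have "\<dots> \<le> c * h ^ n"
    proof -
      have "(4 :: nat) ^ n = 2 ^ n * 2 ^ n" by (simp flip: power_mult_distrib)
      also have "\<dots> \<le> 2 ^ n * (2 * fact n)"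
        by (intro mult_le_mono2 two_power_le_fact)
      finally have "Suc n * 4 ^ n \<le> Suc n * (2 ^ n * (2 * fact n))"
        by (rule mult_le_mono2)
      also have "\<dots> = c" by (simp add: c_def d algebra_simps)
      finally show ?thesis by (simp add: power_mult_distrib mult_le_mono1 flip: mult.assoc)
    qed
    finally have "R < c * h ^ n" .
    obtain a where a: "\<And>q. 0 < q \<Longrightarrow> q \<le> n \<Longrightarrow> a q < h" and R: "R = (\<Sum>q\<le>n. a q * h ^ (n - q))"
      using ex_base_expansion[OF h(1), of n R] by blast
    have "a 0 * h ^ n \<le> R"
      unfolding R using member_le_sum[of 0 "{..n}" "\<lambda>q. a q * h ^ (n - q)"] by simp
    with \<open>R < c * h ^ n\<close> have a0: "a 0 < c"
      by (meson le_less_trans mult_less_cancel2)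
    obtain p :: "'n \<Rightarrow> nat" where p: "bij_betw p UNIV {..<Suc n}"
      using ex_bij_betw_finite_nat[of "UNIV :: 'n set"] d by (auto simp: atLeast0LessThan)
    have pn: "p i \<le> n" for i
      using bij_betwE[OF p] by (auto simp: less_Suc_eq_le)
    have p_inj: "p i = p j \<longleftrightarrow> i = j" for i j
      using bij_betw_imp_inj_on[OF p] by (auto dest: injD)
    \<comment> \<open>The digit goes to the direction of number \<open>0\<close>. For the leading digit, which may exceed \<open>k\<close>,
      this is the direction away from the origin, where there is room for length \<open>c\<close>.\<close>
    define L where "L = (\<lambda>i j. if p j = 0 then a (p i) else if p i < p j then h else 1)"
    \<comment> \<open>A zero digit means no cut.\<close>
    define I where "I = {i. 0 < a (p i)}"
    have prod_L: "(\<Prod>j\<in>UNIV. L i j) = a (p i) * h ^ (n - p i)" for i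
      unfolding L_def
      using prod.reindex_bij_betw[OF p, of "\<lambda>j. if j = 0 then a (p i) else if p i < j then h else 1"]
        prod_digit_times_power[OF pn[of i], of "a (p i)" h] by (rule trans)
    have "(\<Sum>i\<in>I. \<Prod>j\<in>UNIV. L i j) = (\<Sum>i\<in>UNIV. a (p i) * h ^ (n - p i))"
      unfolding prod_L by (rule sum.mono_neutral_left) (auto simp: I_def)
    also have "\<dots> = R"
      unfolding R lessThan_Suc_atMost[symmetric]
      by (rule sum.reindex_bij_betw[OF p])
    finally have "k ^ CARD('n) + (\<Sum>i\<in>I. \<Prod>j\<in>UNIV. L i j) = m"
      by (simp add: m d)
    moreover have L_le: "L i j \<le> h" if "j \<noteq> i" for i j
    proof (cases "p i = 0")
      case True
      with that have "p j \<noteq> 0" using p_inj by metis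
      then show ?thesis using h by (simp add: L_def)
    next
      case False
      then show ?thesis using h a[of "p i"] pn by (simp add: L_def)
    qed
    have L_diag: "L i i \<le> c" for i
      using a0 c by (auto simp: L_def)
    have "\<exists>P \<in> (lattice_polytopes_between r :: (real ^ 'n) set set).
      normalized_volume P = real r ^ CARD('n) - real (k ^ CARD('n) + (\<Sum>i\<in>I. \<Prod>j\<in>UNIV. L i j))"
    proof (rule ex_cut_polytope)
      show "0 < L i j" if "i \<in> I" for i j
        using that h by (auto simp: L_def I_def)
      show "k + L i i \<le> r" for i
        using kr L_diag[of i] by linarith
      show "L i j \<le> k" if "j \<noteq> i" for i j
        using L_le[OF that] h by linarith
      show "L i i' + L i' j \<le> k" if "i' \<noteq> i" "j \<noteq> i'" for i i' j
        using L_le[OF that(1)] L_le[OF that(2)] h by linarith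
    qed (use c kr in auto)
    ultimately show ?thesis by simp
  qed
qed

end
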